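(* There exist absolute constants $\varepsilon_0>0$ and $C>0$ such that for all $0<\varepsilon\le\varepsilon_0$, all integers $d\ge 2$ and $T\ge 1$, and every $\varepsilon$-differentially private online learning algorithm for the class $\mathrm{POINT}_d$ over $T$ rounds, there is an adaptive adversary in the realizable setting against which the expected number of mistakes $\mathbb{E}\left[\sum_{t=1}^T\mathbb{I}[h_t(x_t)\ne y_t]\right]$ of the algorithm is at least $$C\cdot\min\left(\frac{\log d}{\varepsilon},\,T\right).$$
   Context: $\mathrm{POINT}_d$ is the class of point functions over $[d]=\{1,\dots,d\}$: $\mathrm{POINT}_d=\{f_x:x\in[d]\}$ where $f_x:[d]\to\{0,1\}$ maps $x$ to $1$ and all other elements to $0$. Online learning over domain $\mathcal{X}$ (here $\mathcal{X}=[d]$): over $T$ rounds, in round $t$ a (randomized) learner outputs a hypothesis $h_t\in\{0,1\}^{\mathcal{X}}$ (not necessarily in the class), depending only on $(x_1,y_1),\dots,(x_{t-1},y_{t-1})$ and its own randomness, while the adversary presents a pair $(x_t,y_t)\in\mathcal{X}\times\{0,1\}$. An adaptive adversary may choose (possibly at random) $(x_t,y_t)$ based on $h_1,\dots,h_{t-1}$ and $(x_1,y_1),\dots,(x_{t-1},y_{t-1})$. Realizable setting: it is guaranteed that some $h^\star$ in the class satisfies $y_t=h^\star(x_t)$ for all $t\in[T]$. Privacy: with adaptive adversaries, $\varepsilon$-differential privacy of an online algorithm $\mathcal{A}$ means adaptive differential privacy: consider any (privacy) adversary $\mathsf{Adv}$ who adaptively generates two sequences $S_1,S_2$ differing in only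 one entry; for a bit $b\in\{1,2\}$ unknown to $\mathcal{A}$ and $\mathsf{Adv}$, at each time-step $t$ the adversary generates $S_1[t],S_2[t]$ based on the past history and $\mathcal{A}$ receives $S_b[t]$. Let $\mathcal{A}\circ\mathsf{Adv}(b)$ be the view of $\mathsf{Adv}$ (the entire output of $\mathcal{A}$ and the internal randomness of $\mathsf{Adv}$). Then for every such $\mathsf{Adv}$ and every event $O$, $\Pr[\mathcal{A}\circ\mathsf{Adv}(1)\in O]\le e^{\varepsilon}\Pr[\mathcal{A}\circ\mathsf{Adv}(2)\in O]$. (For pure privacy, $\delta=0$, this is known to be equivalent to ordinary $\varepsilon$-differential privacy: $\Pr[\mathcal{A}(S_1)\in O]\le e^{\varepsilon}\Pr[\mathcal{A}(S_2)\in O]$ for all fixed sequences $S_1,S_2$ differing in one entry and all events $O$, where $\mathcal{A}(S)$ is the entire output sequence.) *)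

theory Defs
  imports "HOL-Probability.Probability"
begin

type_synonym 'x hypothesis = "'x \<Rightarrow> bool"
type_synonym 'x example = "'x \<times> bool"

text \<open>
  The label set is \<^typ>\<open>bool\<close>. Hypotheses over a domain \<open>X\<close> are extensional functions, so a
  learner cannot convey anything through values outside \<open>X\<close>.
\<close>

definition hypotheses :: "'x set \<Rightarrow> 'x hypothesis set" where
  "hypotheses X = (X \<rightarrow>\<^sub>E UNIV)"

definition examples :: "'x set \<Rightarrow> 'x example set" where
  "examples X = X \<times> UNIV"

definition point_class :: "nat \<Rightarrow> nat hypothesis set" where
  "point_class d = (\<lambda>x. \<lambda>z\<in>{1..d}. z = x) ` {1..d}"

text \<open>
  A randomized party is a distribution over deterministic strategies: its internal randomness is
  drawn once, before the interaction, and amounts to the choice of a deterministic strategy. Over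
  a finite domain and finitely many rounds there are only finitely many strategies that differ
  in play, so discrete distributions lose no generality, whatever the source of randomness.

  A deterministic learner maps the examples of the earlier rounds to its next hypothesis; a
  deterministic adversary maps the hypotheses and examples of the earlier rounds to its next
  example. Neither sees what the other does in the current round.
\<close>

type_synonym 'x learner = "'x example list \<Rightarrow> 'x hypothesis"
type_synonym 'x adversary = "('x hypothesis \<times> 'x example) list \<Rightarrow> 'x example"

definition valid_learner :: "'x set \<Rightarrow> nat \<Rightarrow> 'x learner \<Rightarrow> bool" where
  "valid_learner X T A \<longleftrightarrow>
     (\<forall>S \<in> lists (examples X). length S < T \<longrightarrow> A S \<in> hypotheses X)"

definition online_algorithm :: "'x set \<Rightarrow> nat \<Rightarrow> 'x learner pmf \<Rightarrow> bool" where
  "online_algorithm X T \<A> \<longleftrightarrow> (\<forall>A \<in> set_pmf \<A>. valid_learner X T A)"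

primrec play :: "'x learner \<Rightarrow> 'x adversary \<Rightarrow> nat \<Rightarrow> ('x hypothesis \<times> 'x example) list" where
  "play A B 0 = []"
| "play A B (Suc t) =
     (let past = play A B t in past @ [(A (map snd past), B past)])"

definition mistakes :: "'x learner \<Rightarrow> 'x adversary \<Rightarrow> nat \<Rightarrow> nat" where
  "mistakes A B T = (\<Sum>(h, x, y) \<leftarrow> play A B T. of_bool (h x \<noteq> y))"

definition expected_mistakes :: "nat \<Rightarrow> 'x learner pmf \<Rightarrow> 'x adversary pmf \<Rightarrow> real" where
  "expected_mistakes T \<A> \<B> =
     measure_pmf.expectation (pair_pmf \<A> \<B>) (\<lambda>(A, B). real (mistakes A B T))"

text \<open>
  Realizability is guaranteed whatever hypotheses the learner outputs; the labelling function may
  depend on the run.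
\<close>

definition realizable_adversary ::
  "'x set \<Rightarrow> 'x hypothesis set \<Rightarrow> nat \<Rightarrow> 'x adversary pmf \<Rightarrow> bool" where
  "realizable_adversary X H T \<B> \<longleftrightarrow>
     (\<forall>B \<in> set_pmf \<B>. \<forall>A. valid_learner X T A \<longrightarrow>
        (\<exists>f \<in> H. \<forall>(h, x, y) \<in> set (play A B T). x \<in> X \<and> y = f x))"

text \<open>
  A privacy adversary produces in each round the pair of the current entries of the two sequences.
  The hidden bit is rendered by the projection \<^const>\<open>fst\<close> or \<^const>\<open>snd\<close> that selects the entry
  handed to the learner.
\<close>

type_synonym 'x privacy_adversary =
  "('x hypothesis \<times> 'x example \<times> 'x example) list \<Rightarrow> 'x example \<times> 'x example"

primrec privacy_play ::
  "('x example \<times> 'x example \<Rightarrow> 'x example) \<Rightarrow> 'x learner \<Rightarrow> 'x privacy_adversary \<Rightarrow> nat \<Rightarrow>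
     ('x hypothesis \<times> 'x example \<times> 'x example) list" where
  "privacy_play sel A D 0 = []"
| "privacy_play sel A D (Suc t) =
     (let past = privacy_play sel A D t
      in past @ [(A (map (sel \<circ> snd) past), D past)])"

definition valid_privacy_adversary ::
  "'x set \<Rightarrow> nat \<Rightarrow> 'x privacy_adversary pmf \<Rightarrow> bool" where
  "valid_privacy_adversary X T \<D> \<longleftrightarrow>
     (\<forall>D \<in> set_pmf \<D>. \<forall>A. valid_learner X T A \<longrightarrow>
        (\<forall>sel \<in> {fst, snd}.
           let run = map snd (privacy_play sel A D T)
           in set run \<subseteq> examples X \<times> examples X \<and>
              card {t. t < T \<and> fst (run ! t) \<noteq> snd (run ! t)} \<le> 1))"

text \<open>The internal randomness of the privacy adversary is its drawn deterministic strategy.\<close>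

definition privacy_view ::
  "('x example \<times> 'x example \<Rightarrow> 'x example) \<Rightarrow> nat \<Rightarrow> 'x learner pmf \<Rightarrow>
     'x privacy_adversary pmf \<Rightarrow> ('x hypothesis list \<times> 'x privacy_adversary) pmf" where
  "privacy_view sel T \<A> \<D> =
     map_pmf (\<lambda>(A, D). (map fst (privacy_play sel A D T), D)) (pair_pmf \<A> \<D>)"

definition adaptively_private :: "'x set \<Rightarrow> nat \<Rightarrow> real \<Rightarrow> 'x learner pmf \<Rightarrow> bool" where
  "adaptively_private X T \<epsilon> \<A> \<longleftrightarrow>
     (\<forall>\<D>. valid_privacy_adversary X T \<D> \<longrightarrow>
        (\<forall>E. measure_pmf.prob (privacy_view fst T \<A> \<D>) E
              \<le> exp \<epsilon> * measure_pmf.prob (privacy_view snd T \<A> \<D>) E))"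

end

theory Submission
  imports Defs
begin

text \<open>
  Against the target \<open>x\<close> the adversary deterministically presents the point on which the learner,
  conditioned on the past, is most likely to err. Hence its expected number of mistakes is at least
  the expected loss of the learner on examples drawn from any distribution that depends on the past.
  We compare with the distribution that puts half of its mass on \<open>x\<close> and spreads the other half by
  multiplicative weights over the points to which the past hypotheses gave the label 1. This loss is
  a function of the hypotheses \<open>hs\<close> only.

  Once \<open>hs\<close> is fixed, so is the stream presented by the adversary. Group privacy over \<open>n\<close> rounds
  therefore bounds the probability of \<open>hs\<close> against every target by \<open>exp (\<epsilon> n)\<close> times its probability
  on one reference stream. The potential of multiplicative weights shows that each \<open>hs\<close> has loss at
  most \<open>n / 8\<close> for at most \<open>d exp (- 3 \<epsilon> n / 2)\<close> targets, as long as \<open>exp (4 \<epsilon> n) \<le> d / 4\<close>. Averaging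
  over the targets yields one that costs \<open>\<Omega>(n)\<close> mistakes, with \<open>n\<close> of order \<open>min (ln d / \<epsilon>) T\<close>.
  If \<open>d\<close> or \<open>\<epsilon> T\<close> is bounded, the same argument with two targets and \<open>\<epsilon> n \<le> 1/3\<close> suffices.
\<close>

section \<open>The greedy adversary\<close>

lemma length_play [simp]: "length (play A B t) = t"
  by (induction t) (auto simp: Let_def)

text \<open>The adversary is not mentioned, so for a fixed transcript \<open>p\<close> this is an
  event about the random learner alone.\<close>

definition consistent :: "'x learner \<Rightarrow> ('x hypothesis \<times> 'x example) list \<Rightarrow> bool" where
  "consistent A p \<longleftrightarrow> (\<forall>s < length p. A (map snd (take s p)) = fst (p ! s))"

lemma consistent_snoc:
  "consistent A (p @ [e]) \<longleftrightarrow> consistent A p \<and> A (map snd p) = fst e"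
  by (auto simp: consistent_def nth_append less_Suc_eq)

text \<open>The adversary's move is the same function of the past in both runs, so they can only
  separate at a round in which the two learners answer differently.\<close>

lemma play_eq_iff_consistent:
  "play A B t = play A' B t \<longleftrightarrow> consistent A (play A' B t)"
proof (induction t)
  case 0
  then show ?case by (simp add: consistent_def)
next
  case (Suc t)
  show ?case using Suc
    by (auto simp: Let_def consistent_snoc)
qed

text \<open>This is a joint rather than a conditional probability. Dividing by the probability of
  \<open>p\<close> would not change the maximizers, and this form also covers transcripts of
  probability zero.\<close>

definition score :: "'x learner pmf \<Rightarrow> 'x hypothesis \<Rightarrow> ('x hypothesis \<times> 'x example) list \<Rightarrow> 'x \<Rightarrow> real"
  where "score \<A> f p z =
    measure_pmf.expectation \<A> (\<lambda>A. of_bool (consistent A p) * of_bool (A (map snd p) z \<noteq> f z))"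

definition greedy :: "'x learner pmf \<Rightarrow> 'x set \<Rightarrow> 'x hypothesis \<Rightarrow> 'x adversary" where
  "greedy \<A> X f p = (let z = (SOME z. z \<in> X \<and> (\<forall>u \<in> X. score \<A> f p u \<le> score \<A> f p z)) in (z, f z))"

lemma greedy_maximizes:
  assumes "finite X" "X \<noteq> {}"
  obtains z where "greedy \<A> X f p = (z, f z)" "z \<in> X" "\<And>u. u \<in> X \<Longrightarrow> score \<A> f p u \<le> score \<A> f p z"
proof -
  have "\<exists>z. z \<in> X \<and> (\<forall>u \<in> X. score \<A> f p u \<le> score \<A> f p z)"
  proof -
    have "Max (score \<A> f p ` X) \<in> score \<A> f p ` X" using assms by auto
    then obtain z where "z \<in> X" "score \<A> f p z = Max (score \<A> f p ` X)" by auto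
    then show ?thesis using assms by (metis Max_ge finite_imageI imageI)
  qed
  from someI_ex[OF this] show ?thesis
    using that unfolding greedy_def Let_def by blast
qed

section \<open>Finitely many transcripts, and splitting expectations over them\<close>

lemma finite_hypotheses: "finite X \<Longrightarrow> finite (hypotheses X)"
  by (simp add: hypotheses_def finite_PiE)

text \<open>The support of \<open>\<A>\<close> may be infinite, but its learners produce only
  finitely many transcripts, because extensional hypotheses over a finite domain are finite in
  number. All expectations thereby become finite sums.\<close>

lemma finite_plays:
  assumes "finite X" "online_algorithm X T \<A>" "\<And>p. B p \<in> examples X" "t \<le> T"
  shows "finite ((\<lambda>A. play A B t) ` set_pmf \<A>)"
proof (rule finite_subset)
  have "set (play A B t) \<subseteq> hypotheses X \<times> examples X" if "A \<in> set_pmf \<A>" for A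
    using assms(4)
  proof (induction t)
    case (Suc t)
    then have IH: "set (play A B t) \<subseteq> hypotheses X \<times> examples X" by simp
    have "map snd (play A B t) \<in> lists (examples X)" "length (map snd (play A B t)) < T"
      using IH Suc.prems by (auto simp: subset_iff)
    then have "A (map snd (play A B t)) \<in> hypotheses X"
      using assms(2) that unfolding online_algorithm_def valid_learner_def by blast
    then show ?case using IH assms(3) by (auto simp: Let_def)
  qed simp
  then show "(\<lambda>A. play A B t) ` set_pmf \<A> \<subseteq> {p. set p \<subseteq> hypotheses X \<times> examples X \<and> length p = t}"
    by auto
  show "finite {p. set p \<subseteq> hypotheses X \<times> examples X \<and> length p = t}"
    using assms(1) by (intro finite_lists_length_eq) (auto simp: finite_hypotheses examples_def)
qed

lemma integrable_finite_image:
  fixes g :: "'b \<Rightarrow> real"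
  assumes "finite (F ` set_pmf M)"
  shows "integrable (measure_pmf M) (\<lambda>a. g (F a))"
proof -
  have "integrable (measure_pmf (map_pmf F M)) g"
    using assms by (intro integrable_measure_pmf_finite) simp
  then show ?thesis by (simp add: integrable_map_pmf_eq)
qed

lemma expectation_partition:
  fixes g :: "'a \<Rightarrow> real"
  assumes fin: "finite (F ` set_pmf M)" and g: "\<And>a. \<bar>g a\<bar> \<le> c"
  shows "measure_pmf.expectation M g =
    (\<Sum>p \<in> F ` set_pmf M. measure_pmf.expectation M (\<lambda>a. of_bool (F a = p) * g a))"
proof -
  have int: "integrable (measure_pmf M) (\<lambda>a. of_bool (F a = p) * g a)" for p
  proof (rule measure_pmf.integrable_const_bound[where B = c])
    have "0 \<le> c" using g[of undefined] by linarith
    then show "AE a in measure_pmf M. norm (of_bool (F a = p) * g a) \<le> c"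
      using g by (auto simp: of_bool_def)
  qed simp
  have "measure_pmf.expectation M g =
      measure_pmf.expectation M (\<lambda>a. \<Sum>p \<in> F ` set_pmf M. of_bool (F a = p) * g a)"
  proof (intro integral_cong_AE AE_pmfI)
    fix a assume "a \<in> set_pmf M"
    then have "F a \<in> F ` set_pmf M" by simp
    then show "g a = (\<Sum>p \<in> F ` set_pmf M. of_bool (F a = p) * g a)"
      using fin by (simp add: of_bool_def if_distrib[of "\<lambda>c. c * g a"] cong: if_cong)
  qed simp_all
  also have "\<dots> = (\<Sum>p \<in> F ` set_pmf M. measure_pmf.expectation M (\<lambda>a. of_bool (F a = p) * g a))"
    by (rule Bochner_Integration.integral_sum) (rule int)
  finally show ?thesis .
qed

text \<open>Given the past, an average of error probabilities with total weight at most 1 cannot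
  exceed the largest of them, which is the one that \<open>greedy\<close> attains. The weights may
  vary with the past, since they are constant on each cell of the partition by transcripts.\<close>

lemma greedy_round:
  fixes v :: "('x hypothesis \<times> 'x example) list \<Rightarrow> 'x \<Rightarrow> real"
  assumes X: "finite X" "X \<noteq> {}"
    and fin: "finite ((\<lambda>A. play A (greedy \<A> X f) t) ` set_pmf \<A>)"
    and v: "\<And>p z. 0 \<le> v p z" "\<And>p. (\<Sum>z \<in> X. v p z) \<le> 1"
  defines "past \<equiv> \<lambda>A. play A (greedy \<A> X f) t"
  shows "measure_pmf.expectation \<A>
      (\<lambda>A. \<Sum>z \<in> X. v (past A) z * of_bool (A (map snd (past A)) z \<noteq> f z))
    \<le> measure_pmf.expectation \<A> (\<lambda>A. of_bool (A (map snd (past A)) (fst (greedy \<A> X f (past A)))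
        \<noteq> snd (greedy \<A> X f (past A))))"
    (is "measure_pmf.expectation \<A> ?l \<le> measure_pmf.expectation \<A> ?r")
proof -
  have fin': "finite (past ` set_pmf \<A>)" using fin by (simp add: past_def)
  have "0 \<le> ?l A \<and> ?l A \<le> 1" for A
  proof -
    have "?l A \<le> (\<Sum>z \<in> X. v (past A) z)"
      by (rule sum_mono) (auto simp: v(1))
    then show ?thesis using v(2)[of "past A"] by (auto intro!: sum_nonneg simp: v(1))
  qed
  then have "\<bar>?l A\<bar> \<le> 1" for A by (simp only: abs_of_nonneg)
  then have "measure_pmf.expectation \<A> ?l
      = (\<Sum>p \<in> past ` set_pmf \<A>. measure_pmf.expectation \<A> (\<lambda>A. of_bool (past A = p) * ?l A))"
    by (intro expectation_partition[where c = 1] fin')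
  also have "\<dots> \<le> (\<Sum>p \<in> past ` set_pmf \<A>. measure_pmf.expectation \<A> (\<lambda>A. of_bool (past A = p) * ?r A))"
  proof (rule sum_mono)
    fix p assume "p \<in> past ` set_pmf \<A>"
    then obtain A' where "p = past A'" by auto
    \<comment> \<open>Since \<open>p\<close> is itself produced by a run against
      \<open>greedy\<close>, reaching it means being consistent with it, and this is the event in
      \<open>score\<close>.\<close>
    then have cons: "past A = p \<longleftrightarrow> consistent A p" for A
      unfolding past_def by (simp add: play_eq_iff_consistent)
    obtain z where z: "greedy \<A> X f p = (z, f z)" "\<And>u. u \<in> X \<Longrightarrow> score \<A> f p u \<le> score \<A> f p z"
      using greedy_maximizes[OF X] by metis
    have "measure_pmf.expectation \<A> (\<lambda>A. of_bool (past A = p) * ?l A)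
       = measure_pmf.expectation \<A> (\<lambda>A. \<Sum>u \<in> X. v p u *
           (of_bool (consistent A p) * of_bool (A (map snd p) u \<noteq> f u)))"
      by (intro Bochner_Integration.integral_cong refl)
        (auto simp: cons[symmetric])
    also have "\<dots> = (\<Sum>u \<in> X. v p u * score \<A> f p u)"
      unfolding score_def
    proof (subst Bochner_Integration.integral_sum)
      show "integrable (measure_pmf \<A>) (\<lambda>A. v p u *
           (of_bool (consistent A p) * of_bool (A (map snd p) u \<noteq> f u)))" for u
        by (rule measure_pmf.integrable_const_bound[where B = "v p u"]) (auto simp: v(1))
    qed simp
    also have "\<dots> \<le> (\<Sum>u \<in> X. v p u * score \<A> f p z)"
      by (intro sum_mono mult_left_mono z(2) v(1))
    also have "\<dots> = (\<Sum>u \<in> X. v p u) * score \<A> f p z" by (simp add: sum_distrib_right)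
    also have "\<dots> \<le> 1 * score \<A> f p z"
      by (intro mult_right_mono v(2)) (auto simp: score_def)
    also have "\<dots> = measure_pmf.expectation \<A> (\<lambda>A. of_bool (past A = p) * ?r A)"
      unfolding mult_1 score_def
      by (intro Bochner_Integration.integral_cong refl) (auto simp: cons[symmetric] z(1))
    finally show "measure_pmf.expectation \<A> (\<lambda>A. of_bool (past A = p) * ?l A)
      \<le> measure_pmf.expectation \<A> (\<lambda>A. of_bool (past A = p) * ?r A)" .
  qed
  also have "\<dots> = measure_pmf.expectation \<A> ?r"
    by (intro expectation_partition[where c = 1, symmetric] fin') auto
  finally show ?thesis .
qed


section \<open>Cumulative weighted loss versus mistakes\<close>

definition loss ::
  "('x hypothesis list \<Rightarrow> 'x \<Rightarrow> real) \<Rightarrow> 'x hypothesis \<Rightarrow> 'x set \<Rightarrow> 'x hypothesis list \<Rightarrow> real" where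
  "loss v f X hs = (\<Sum>t < length hs. \<Sum>z \<in> X. v (take t hs) z * of_bool ((hs ! t) z \<noteq> f z))"

lemma loss_Nil [simp]: "loss v f X [] = 0"
  by (simp add: loss_def)

lemma loss_snoc:
  "loss v f X (hs @ [h]) = loss v f X hs + (\<Sum>z \<in> X. v hs z * of_bool (h z \<noteq> f z))"
  by (simp add: loss_def nth_append)

lemma loss_nonneg: "(\<And>hs z. 0 \<le> v hs z) \<Longrightarrow> 0 \<le> loss v f X hs"
  unfolding loss_def by (intro sum_nonneg) auto

lemma mistakes_0 [simp]: "mistakes A B 0 = 0"
  by (simp add: mistakes_def)

lemma mistakes_Suc:
  "mistakes A B (Suc t) = mistakes A B t +
     of_bool (A (map snd (play A B t)) (fst (B (play A B t))) \<noteq> snd (B (play A B t)))"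
  by (simp add: mistakes_def Let_def split: prod.split)

lemma mistakes_mono: "s \<le> t \<Longrightarrow> mistakes A B s \<le> mistakes A B t"
  by (induction t rule: dec_induct) (auto simp: mistakes_Suc)

text \<open>Sums \<open>greedy_round\<close> over the rounds. It moves the problem from mistakes,
  which depend on the adversary's examples, to a loss determined by the hypotheses, to which privacy
  applies.\<close>

lemma expectation_loss_le_mistakes:
  fixes v :: "'x hypothesis list \<Rightarrow> 'x \<Rightarrow> real" and f :: "'x hypothesis"
  assumes X: "finite X" "X \<noteq> {}" and alg: "online_algorithm X T \<A>" and "t \<le> T"
    and v: "\<And>hs z. 0 \<le> v hs z" "\<And>hs. (\<Sum>z \<in> X. v hs z) \<le> 1"
  defines "B \<equiv> greedy \<A> X f"
  shows "measure_pmf.expectation \<A> (\<lambda>A. loss v f X (map fst (play A B t)))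
    \<le> measure_pmf.expectation \<A> (\<lambda>A. real (mistakes A B t))"
  using \<open>t \<le> T\<close>
proof (induction t)
  case (Suc t)
  have "B p \<in> examples X" for p
    unfolding B_def examples_def using greedy_maximizes[OF X, of \<A> f p] by force
  then have fin: "finite ((\<lambda>A. play A B t) ` set_pmf \<A>)" if "t \<le> T" for t
    using finite_plays[OF X(1) alg _ that] by blast
  let ?l = "\<lambda>A. \<Sum>z \<in> X. v (map fst (play A B t)) z * of_bool (A (map snd (play A B t)) z \<noteq> f z)"
  let ?r = "\<lambda>A. of_bool (A (map snd (play A B t)) (fst (B (play A B t))) \<noteq> snd (B (play A B t))) :: real"
  have int: "integrable (measure_pmf \<A>) (\<lambda>A. g (play A B t))" for g :: "_ \<Rightarrow> real"
    using fin[of t] Suc.prems by (intro integrable_finite_image) simp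
  have int': "integrable (measure_pmf \<A>) (\<lambda>A. g (play A B (Suc t)))" for g :: "_ \<Rightarrow> real"
    using fin[of "Suc t"] Suc.prems by (intro integrable_finite_image) 
  have intl: "integrable (measure_pmf \<A>) ?l"
    \<comment> \<open>The past and the new hypothesis are both read off the transcript of
      \<open>Suc t\<close> rounds, which takes finitely many values.\<close>
    using int'[of "\<lambda>p. \<Sum>z \<in> X. v (map fst (butlast p)) z * of_bool (fst (last p) z \<noteq> f z)"]
    by (simp add: Let_def)
  have intr: "integrable (measure_pmf \<A>) ?r"
    by (rule measure_pmf.integrable_const_bound[where B = 1]) auto
  have "measure_pmf.expectation \<A> (\<lambda>A. loss v f X (map fst (play A B (Suc t))))
    = measure_pmf.expectation \<A> (\<lambda>A. loss v f X (map fst (play A B t)) + ?l A)"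
    by (simp add: Let_def loss_snoc)
  also have "\<dots> = measure_pmf.expectation \<A> (\<lambda>A. loss v f X (map fst (play A B t)))
      + measure_pmf.expectation \<A> ?l"
    by (rule Bochner_Integration.integral_add[OF int intl])
  also have "\<dots> \<le> measure_pmf.expectation \<A> (\<lambda>A. real (mistakes A B t)) + measure_pmf.expectation \<A> ?r"
  proof (rule add_mono)
    show "measure_pmf.expectation \<A> ?l \<le> measure_pmf.expectation \<A> ?r"
      unfolding B_def
      by (rule greedy_round[where v = "\<lambda>p. v (map fst p)", OF X])
        (use fin[of t] Suc.prems v in \<open>auto simp: B_def\<close>)
  qed (use Suc in auto)
  also have "\<dots> = measure_pmf.expectation \<A> (\<lambda>A. real (mistakes A B t) + ?r A)"
    by (rule Bochner_Integration.integral_add[symmetric, OF _ intr])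
      (unfold mistakes_def, rule int)
  also have "\<dots> = measure_pmf.expectation \<A> (\<lambda>A. real (mistakes A B (Suc t)))"
    by (simp add: mistakes_Suc)
  finally show ?case .
qed simp

section \<open>Group privacy against adaptive adversaries\<close>

definition outputs :: "'x learner \<Rightarrow> (nat \<Rightarrow> 'x example) \<Rightarrow> nat \<Rightarrow> 'x hypothesis list" where
  "outputs A s n = map (\<lambda>t. A (map s [0..<t])) [0..<n]"

lemma length_outputs [simp]: "length (outputs A s n) = n"
  by (simp add: outputs_def)

lemma outputs_Suc: "outputs A s (Suc n) = outputs A s n @ [A (map s [0..<n])]"
  by (simp add: outputs_def)

lemma take_outputs: "n \<le> T \<Longrightarrow> take n (outputs A s T) = outputs A s n"
  by (simp add: outputs_def take_map)

lemma outputs_cong: "(\<And>t. t < n \<Longrightarrow> s t = s' t) \<Longrightarrow> outputs A s n = outputs A s' n"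
  by (auto simp: outputs_def intro!: arg_cong[of _ _ A])

text \<open>An oblivious privacy adversary: both sequences are fixed in advance and only the round
  number is read off the past.\<close>

definition stream_pair ::
  "(nat \<Rightarrow> 'x example) \<Rightarrow> (nat \<Rightarrow> 'x example) \<Rightarrow> 'x privacy_adversary" where
  "stream_pair s s' past = (s (length past), s' (length past))"

lemma privacy_play_stream_pair:
  shows "map fst (privacy_play sel A (stream_pair s s') n) = outputs A (\<lambda>t. sel (s t, s' t)) n"
    and "map snd (privacy_play sel A (stream_pair s s') n) = map (\<lambda>t. (s t, s' t)) [0..<n]"
proof -
  have len: "length (privacy_play sel A (stream_pair s s') n) = n" for n
    by (induction n) (auto simp: Let_def)
  show snd: "map snd (privacy_play sel A (stream_pair s s') n) = map (\<lambda>t. (s t, s' t)) [0..<n]" for n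
    by (induction n)
      (auto simp: Let_def len stream_pair_def[of _ _ "privacy_play sel A (stream_pair s s') _"])
  have "map (sel \<circ> snd) (privacy_play sel A (stream_pair s s') n) = map (\<lambda>t. sel (s t, s' t)) [0..<n]" for n
    using arg_cong[OF snd[of n], of "map sel"] by (simp add: comp_def)
  then show "map fst (privacy_play sel A (stream_pair s s') n) = outputs A (\<lambda>t. sel (s t, s' t)) n"
    by (induction n) (simp_all add: Let_def outputs_Suc, simp add: outputs_def)
qed

lemma private_neighbouring_streams:
  assumes priv: "adaptively_private X T \<epsilon> \<A>" and "n \<le> T"
    and s: "\<And>t. s t \<in> examples X" "\<And>t. s' t \<in> examples X" "\<And>t. t \<noteq> i \<Longrightarrow> s t = s' t"
  shows "measure_pmf.prob \<A> {A. outputs A s n = hs}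
    \<le> exp \<epsilon> * measure_pmf.prob \<A> {A. outputs A s' n = hs}"
proof -
  have differ: "t = i" if "s t \<noteq> s' t" for t using s(3)[of t] that by blast
  define D where "D = stream_pair s s'"
  have valid: "valid_privacy_adversary X T (return_pmf D)"
    unfolding valid_privacy_adversary_def Let_def
  proof (intro ballI allI impI conjI)
    fix D' :: "'a privacy_adversary" and A :: "'a learner" and sel :: "'a example \<times> 'a example \<Rightarrow> 'a example"
    assume "D' \<in> set_pmf (return_pmf D)"
    then have D': "D' = D" by simp
    show "set (map snd (privacy_play sel A D' T)) \<subseteq> examples X \<times> examples X"
      unfolding D' D_def privacy_play_stream_pair(2) using s by auto
    have "{t. t < T \<and> fst (map snd (privacy_play sel A D' T) ! t) \<noteq> snd (map snd (privacy_play sel A D' T) ! t)}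
        \<subseteq> {i}"
      unfolding D' D_def privacy_play_stream_pair(2) by (auto dest: differ)
    from card_mono[OF _ this] show "card {t. t < T \<and> fst (map snd (privacy_play sel A D' T) ! t) \<noteq> snd (map snd (privacy_play sel A D' T) ! t)} \<le> 1"
      by simp
  qed
  \<comment> \<open>Privacy concerns all \<open>T\<close> outputs; an event that looks only at the
    first \<open>n\<close> of them transfers the bound to prefixes.\<close>
  define E :: "('a hypothesis list \<times> 'a privacy_adversary) set" where "E = {(hs', _). take n hs' = hs}"
  have view: "measure_pmf.prob (privacy_view sel T \<A> (return_pmf D)) E
      = measure_pmf.prob \<A> {A. outputs A (\<lambda>t. sel (s t, s' t)) n = hs}" for sel
    unfolding privacy_view_def pair_return_pmf2
    unfolding map_pmf_comp prod.case measure_map_pmf E_def vimage_def D_def privacy_play_stream_pair(1)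
    by (simp only: mem_Collect_eq prod.case take_outputs[OF \<open>n \<le> T\<close>])
  show ?thesis
    using priv[unfolded adaptively_private_def, rule_format, OF valid, of E] unfolding view by simp
qed

lemma group_privacy:
  assumes priv: "adaptively_private X T \<epsilon> \<A>" and "n \<le> T"
    and s: "\<And>t. s t \<in> examples X" "\<And>t. s' t \<in> examples X"
  shows "measure_pmf.prob \<A> {A. outputs A s n = hs}
    \<le> exp (\<epsilon> * real n) * measure_pmf.prob \<A> {A. outputs A s' n = hs}"
proof -
  \<comment> \<open>Hybrid streams: \<open>?h k\<close> and \<open>?h (Suc k)\<close> differ at most
    in entry \<open>k\<close>, and \<open>?h n\<close> agrees with \<open>s\<close> on the first
    \<open>n\<close> rounds. Each step costs a factor \<open>exp \<epsilon>\<close>.\<close>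
  let ?h = "\<lambda>k t. if t < k then s t else s' t"
  have "measure_pmf.prob \<A> {A. outputs A (?h k) n = hs}
    \<le> exp (\<epsilon> * real k) * measure_pmf.prob \<A> {A. outputs A s' n = hs}" for k
  proof (induction k)
    case (Suc k)
    have "measure_pmf.prob \<A> {A. outputs A (?h (Suc k)) n = hs}
        \<le> exp \<epsilon> * measure_pmf.prob \<A> {A. outputs A (?h k) n = hs}"
      by (rule private_neighbouring_streams[OF priv \<open>n \<le> T\<close>, where i = k]) (use s in auto)
    also have "\<dots> \<le> exp \<epsilon> * (exp (\<epsilon> * real k) * measure_pmf.prob \<A> {A. outputs A s' n = hs})"
      by (intro mult_left_mono Suc) simp
    also have "\<dots> = exp (\<epsilon> * real (Suc k)) * measure_pmf.prob \<A> {A. outputs A s' n = hs}"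
      by (simp add: exp_add ring_distribs)
    finally show ?case .
  qed simp
  from this[of n] show ?thesis
    unfolding outputs_cong[of n "?h n" s, simplified] .
qed

text \<open>
  Running \<open>replay hs\<close> against an adversary recovers the stream that it presents to any learner whose
  hypotheses are \<open>hs\<close>; this is what reduces an adaptive adversary to a fixed stream.
\<close>

definition replay :: "'x hypothesis list \<Rightarrow> 'x learner" where
  "replay hs S = hs ! length S"

text \<open>As long as the answers follow \<open>hs\<close>, the interactive run and the fixed
  stream feed the learner the same examples, so a first deviation from \<open>hs\<close> shows up in
  the same round of both.\<close>

lemma play_eq_outputs_iff:
  assumes "length hs = n"
  shows "map fst (play A B n) = hs \<longleftrightarrow> outputs A (\<lambda>t. B (play (replay hs) B t)) n = hs"
proof -
  let ?s = "\<lambda>t. B (play (replay hs) B t)"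
  have replay: "map snd (play (replay hs) B k) = map ?s [0..<k]" "map fst (play (replay hs) B k) = map ((!) hs) [0..<k]" for k
    by (induction k) (auto simp: Let_def replay_def[of hs "map snd _"])
  \<comment> \<open>The second conjunct strengthens the induction: equal hypotheses force equal
    examples, which determine the next answer.\<close>
  have "(map fst (play A B k) = map ((!) hs) [0..<k] \<longleftrightarrow> outputs A ?s k = map ((!) hs) [0..<k])
    \<and> (map fst (play A B k) = map ((!) hs) [0..<k] \<longrightarrow> play A B k = play (replay hs) B k)" for k
  proof (induction k)
    case (Suc k)
    have lhs: "map fst (play A B (Suc k)) = map ((!) hs) [0..<Suc k] \<longleftrightarrow>
        map fst (play A B k) = map ((!) hs) [0..<k] \<and> A (map snd (play A B k)) = hs ! k"
      by (simp add: Let_def)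
    have rhs: "outputs A ?s (Suc k) = map ((!) hs) [0..<Suc k] \<longleftrightarrow>
        outputs A ?s k = map ((!) hs) [0..<k] \<and> A (map snd (play (replay hs) B k)) = hs ! k"
      by (simp add: outputs_Suc replay(1))
    have step: "play A B (Suc k) = play (replay hs) B (Suc k)"
      if "play A B k = play (replay hs) B k" "A (map snd (play (replay hs) B k)) = hs ! k"
      using that by (simp add: Let_def replay_def[of hs "map snd (play (replay hs) B k)"])
    show ?case unfolding lhs rhs using Suc step by metis
  qed (simp add: outputs_def)
  from this[of n] have "map fst (play A B n) = map ((!) hs) [0..<n]
      \<longleftrightarrow> outputs A ?s n = map ((!) hs) [0..<n]" ..
  moreover have "map ((!) hs) [0..<n] = hs" using assms(1) map_nth by metis
  ultimately show ?thesis by simp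
qed

text \<open>The fixed stream that simulates \<open>B\<close> depends on \<open>hs\<close>, so the
  comparison is made one \<open>hs\<close> at a time. The reference stream on the right depends on
  neither \<open>B\<close> nor \<open>hs\<close>, which allows different targets to be compared with
  one distribution.\<close>

lemma private_play:
  assumes priv: "adaptively_private X T \<epsilon> \<A>" and "n \<le> T"
    and B: "\<And>p. B p \<in> examples X" and e: "e \<in> examples X"
  shows "measure_pmf.prob \<A> {A. map fst (play A B n) = hs}
    \<le> exp (\<epsilon> * real n) * measure_pmf.prob \<A> {A. outputs A (\<lambda>_. e) n = hs}"
proof (cases "length hs = n")
  case True
  then show ?thesis
    unfolding play_eq_outputs_iff[OF True] by (intro group_privacy[OF priv \<open>n \<le> T\<close>] B e)
next
  case False
  then have "{A. map fst (play A B n) = hs} = {}" by auto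
  then show ?thesis by simp
qed


section \<open>From single transcripts to events, and averaging over the targets\<close>

lemma prob_event_le:
  fixes F G :: "'a \<Rightarrow> 'b"
  assumes fin: "finite (F ` set_pmf M)" and "0 \<le> c"
    and le: "\<And>y. measure_pmf.prob M {a. F a = y} \<le> c * measure_pmf.prob M {a. G a = y}"
  shows "measure_pmf.prob M {a. F a \<in> E} \<le> c * measure_pmf.prob M {a. G a \<in> E}"
proof -
  let ?S = "E \<inter> F ` set_pmf M"
  have pmf: "pmf (map_pmf H M) y = measure_pmf.prob M {a. H a = y}" for H :: "'a \<Rightarrow> 'b" and y
    by (simp add: pmf_map vimage_def)
  have prob: "measure_pmf.prob (map_pmf H M) D = measure_pmf.prob M {a. H a \<in> D}" for H :: "'a \<Rightarrow> 'b" and D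
    by (simp add: vimage_def)
  have "measure_pmf.prob M {a. F a \<in> E} = measure_pmf.prob (map_pmf F M) (E \<inter> set_pmf (map_pmf F M))"
    unfolding prob[symmetric] by (rule measure_Int_set_pmf[symmetric])
  also have "\<dots> = (\<Sum>y \<in> ?S. pmf (map_pmf F M) y)"
    using fin by (subst measure_measure_pmf_finite) auto
  also have "\<dots> \<le> (\<Sum>y \<in> ?S. c * pmf (map_pmf G M) y)"
    unfolding pmf by (intro sum_mono le)
  also have "\<dots> = c * measure_pmf.prob (map_pmf G M) ?S"
    using fin by (simp add: measure_measure_pmf_finite sum_distrib_left del: measure_map_pmf)
  also have "\<dots> \<le> c * measure_pmf.prob (map_pmf G M) E"
    using \<open>0 \<le> c\<close> by (intro mult_left_mono measure_pmf.finite_measure_mono) auto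
  finally show ?thesis unfolding prob .
qed

text \<open>By \<open>few\<close>, the expected number of cheap targets on the reference stream is
  at most \<open>3/4 * card Y / exp (\<epsilon> * n)\<close>. Some target is thus cheap there with
  probability at most \<open>3/4 / exp (\<epsilon> * n)\<close>. Passing to its own greedy adversary
  costs the factor \<open>exp (\<epsilon> * n)\<close>, so with probability at least 1/4 the loss
  exceeds \<open>r\<close>.\<close>

lemma exists_costly_target:
  fixes f :: "'i \<Rightarrow> 'x hypothesis" and v :: "'i \<Rightarrow> 'x hypothesis list \<Rightarrow> 'x \<Rightarrow> real"
  assumes X: "finite X" "X \<noteq> {}" and alg: "online_algorithm X T \<A>"
    and priv: "adaptively_private X T \<epsilon> \<A>" and "n \<le> T" and Y: "finite Y" "Y \<noteq> {}"
    and v: "\<And>i hs z. i \<in> Y \<Longrightarrow> 0 \<le> v i hs z" "\<And>i hs. i \<in> Y \<Longrightarrow> (\<Sum>z \<in> X. v i hs z) \<le> 1"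
    and "0 \<le> r"
    and few: "\<And>hs. length hs = n \<Longrightarrow>
      exp (\<epsilon> * real n) * real (card {i \<in> Y. loss (v i) (f i) X hs \<le> r}) \<le> 3/4 * real (card Y)"
  shows "\<exists>i \<in> Y. r / 4 \<le> measure_pmf.expectation \<A> (\<lambda>A. real (mistakes A (greedy \<A> X (f i)) n))"
proof -
  define B where "B i = greedy \<A> X (f i)" for i
  define bad where "bad i = {hs. loss (v i) (f i) X hs \<le> r}" for i
  obtain z0 where "z0 \<in> X" using X by blast
  \<comment> \<open>The run on the reference stream; the constant example in it is
    arbitrary.\<close>
  define G where "G A = outputs A (\<lambda>_. (z0, True)) n" for A :: "'x learner"
  let ?c = "exp (\<epsilon> * real n)"
  have B: "B i p \<in> examples X" for i p
    unfolding B_def examples_def using greedy_maximizes[OF X, of \<A> "f i" p] by force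
  then have fin: "finite ((\<lambda>A. play A (B i) n) ` set_pmf \<A>)" for i
    using finite_plays[OF X(1) alg _ \<open>n \<le> T\<close>] by blast
  have "(\<Sum>i \<in> Y. measure_pmf.prob \<A> {A. G A \<in> bad i})
      = (\<Sum>i \<in> Y. measure_pmf.expectation \<A> (\<lambda>A. indicator {A. G A \<in> bad i} A))"
    by simp
  also have "\<dots> = measure_pmf.expectation \<A> (\<lambda>A. \<Sum>i \<in> Y. indicator {A. G A \<in> bad i} A)"
    by (rule Bochner_Integration.integral_sum[symmetric])
      (rule measure_pmf.integrable_const_bound[where B = 1], auto)
  also have "\<dots> = measure_pmf.expectation \<A> (\<lambda>A. real (card {i \<in> Y. loss (v i) (f i) X (G A) \<le> r}))"
    using Y(1) by (simp add: indicator_def bad_def sum.If_cases Int_def flip: of_bool_def) 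
  also have "\<dots> \<le> measure_pmf.expectation \<A> (\<lambda>A. 3/4 * real (card Y) / ?c)"
  proof (rule integral_mono)
    show "integrable (measure_pmf \<A>) (\<lambda>A. real (card {i \<in> Y. loss (v i) (f i) X (G A) \<le> r}))"
      by (rule measure_pmf.integrable_const_bound[where B = "real (card Y)"])
        (auto intro!: card_mono Y(1))
    fix A :: "'x learner"
    show "real (card {i \<in> Y. loss (v i) (f i) X (G A) \<le> r}) \<le> 3/4 * real (card Y) / ?c"
      using few[of "G A"] by (simp add: G_def field_simps)
  qed simp
  also have "\<dots> = (\<Sum>i \<in> Y. 3/4 / ?c)" by simp
  finally have sum_le: "(\<Sum>i \<in> Y. measure_pmf.prob \<A> {A. G A \<in> bad i}) \<le> (\<Sum>i \<in> Y. 3/4 / ?c)" .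
  have "\<exists>i \<in> Y. measure_pmf.prob \<A> {A. G A \<in> bad i} \<le> 3/4 / ?c"
  proof (rule ccontr)
    assume "\<not> ?thesis"
    then have "(\<Sum>i \<in> Y. 3/4 / ?c) < (\<Sum>i \<in> Y. measure_pmf.prob \<A> {A. G A \<in> bad i})"
      by (intro sum_strict_mono Y) (auto simp: not_le)
    with sum_le show False by simp
  qed
  then obtain i where i: "i \<in> Y" "measure_pmf.prob \<A> {A. G A \<in> bad i} \<le> 3/4 / ?c" by blast
  define Bad where "Bad = {A. map fst (play A (B i) n) \<in> bad i}"
  have "measure_pmf.prob \<A> Bad \<le> ?c * measure_pmf.prob \<A> {A. G A \<in> bad i}"
    unfolding Bad_def
  proof (rule prob_event_le)
    have "(\<lambda>A. map fst (play A (B i) n)) ` set_pmf \<A> = map fst ` (\<lambda>A. play A (B i) n) ` set_pmf \<A>"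
      by (simp add: image_image)
    then show "finite ((\<lambda>A. map fst (play A (B i) n)) ` set_pmf \<A>)" using fin by simp
    show "measure_pmf.prob \<A> {A. map fst (play A (B i) n) = hs} \<le> ?c * measure_pmf.prob \<A> {A. G A = hs}" for hs
      unfolding G_def
      by (rule private_play[OF priv \<open>n \<le> T\<close> B]) (use \<open>z0 \<in> X\<close> in \<open>simp add: examples_def\<close>)
  qed simp
  also have "\<dots> \<le> ?c * (3/4 / ?c)" using i(2) by (intro mult_left_mono) auto
  finally have Bad: "measure_pmf.prob \<A> Bad \<le> 3/4" by simp
  have "r / 4 \<le> r * measure_pmf.prob \<A> (- Bad)"
    using Bad mult_left_mono[of "1/4" "measure_pmf.prob \<A> (- Bad)" r] \<open>0 \<le> r\<close>
    by (simp add: measure_pmf.prob_compl[of Bad, simplified, folded Compl_eq_Diff_UNIV])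
  also have "\<dots> = measure_pmf.expectation \<A> (\<lambda>A. r * indicator (- Bad) A)" by simp
  \<comment> \<open>Outside \<open>Bad\<close> the loss exceeds \<open>r\<close>; on
    \<open>Bad\<close> it is at least 0.\<close>
  also have "\<dots> \<le> measure_pmf.expectation \<A> (\<lambda>A. loss (v i) (f i) X (map fst (play A (B i) n)))"
  proof (rule integral_mono)
    show "integrable (measure_pmf \<A>) (\<lambda>A. r * indicator (- Bad) A)"
      by (rule measure_pmf.integrable_const_bound[where B = r]) (use \<open>0 \<le> r\<close> in \<open>auto simp: indicator_def\<close>)
    show "integrable (measure_pmf \<A>) (\<lambda>A. loss (v i) (f i) X (map fst (play A (B i) n)))"
      by (rule integrable_finite_image[OF fin])
    show "r * indicator (- Bad) A \<le> loss (v i) (f i) X (map fst (play A (B i) n))" for A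
      using loss_nonneg[of "v i"] v(1)[OF i(1)]
      by (auto simp: indicator_def Bad_def bad_def)
  qed
  also have "\<dots> \<le> measure_pmf.expectation \<A> (\<lambda>A. real (mistakes A (B i) n))"
    unfolding B_def by (rule expectation_loss_le_mistakes[OF X alg \<open>n \<le> T\<close>]) (use v[OF i(1)] in auto)
  finally show ?thesis using i(1) unfolding B_def by blast
qed

section \<open>Multiplicative weights\<close>

abbreviation hits :: "'x hypothesis list \<Rightarrow> 'x \<Rightarrow> real" where
  "hits hs z \<equiv> real (length (filter (\<lambda>h. h z) hs))"

definition potential :: "real \<Rightarrow> 'x set \<Rightarrow> 'x hypothesis list \<Rightarrow> real" where
  "potential \<eta> X hs = (\<Sum>z \<in> X. exp (\<eta> * hits hs z))"

definition mw_weight :: "real \<Rightarrow> 'x set \<Rightarrow> 'x hypothesis list \<Rightarrow> 'x \<Rightarrow> real" where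
  "mw_weight \<eta> X hs z = exp (\<eta> * hits hs z) / potential \<eta> X hs"

text \<open>
  The multiplicative weight of \<open>x\<close> itself is dropped, so the total mass may be less than 1.
\<close>

definition point_weight :: "real \<Rightarrow> 'x set \<Rightarrow> 'x \<Rightarrow> 'x hypothesis list \<Rightarrow> 'x \<Rightarrow> real" where
  "point_weight \<eta> X x hs z = (if z = x then 1/2 else mw_weight \<eta> X hs z / 2)"

lemma potential_pos: "finite X \<Longrightarrow> X \<noteq> {} \<Longrightarrow> 0 < potential \<eta> X hs"
  unfolding potential_def by (intro sum_pos) auto

lemma mw_weight_nonneg: "0 \<le> mw_weight \<eta> X hs z"
  by (simp add: mw_weight_def potential_def sum_nonneg)

lemma sum_mw_weight: "finite X \<Longrightarrow> X \<noteq> {} \<Longrightarrow> (\<Sum>z \<in> X. mw_weight \<eta> X hs z) = 1"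
  using potential_pos[of X \<eta> hs]
  by (simp add: mw_weight_def potential_def flip: sum_divide_distrib)

lemma sum_point_weight_le:
  assumes "finite X" "x \<in> X"
  shows "(\<Sum>z \<in> X. point_weight \<eta> X x hs z) \<le> 1"
proof -
  have "(\<Sum>z \<in> X. point_weight \<eta> X x hs z) = 1/2 + (\<Sum>z \<in> X - {x}. mw_weight \<eta> X hs z / 2)"
    using assms by (simp add: sum.remove point_weight_def)
  also have "\<dots> \<le> 1/2 + (\<Sum>z \<in> X. mw_weight \<eta> X hs z / 2)"
    using assms by (intro add_left_mono sum_mono2) (auto simp: mw_weight_nonneg)
  also have "\<dots> = 1"
    using assms sum_mw_weight[of X \<eta> hs] by (fastforce simp flip: sum_divide_distrib)
  finally show ?thesis .
qed

text \<open>The loss against the constantly false function is the accumulated weight of the points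
  labelled 1. A round in which this weight is \<open>p\<close> multiplies the potential by
  \<open>1 + (exp \<eta> - 1) * p\<close>, which is at most
  \<open>exp ((exp \<eta> - 1) * p)\<close>.\<close>

lemma potential_le:
  assumes "finite X" "X \<noteq> {}" "0 \<le> \<eta>"
  shows "potential \<eta> X hs \<le> real (card X) * exp ((exp \<eta> - 1) * loss (mw_weight \<eta> X) (\<lambda>_. False) X hs)"
proof (induction hs rule: rev_induct)
  case Nil
  then show ?case by (simp add: potential_def)
next
  case (snoc h hs)
  let ?W = "potential \<eta> X hs" and ?p = "\<Sum>z \<in> X. mw_weight \<eta> X hs z * of_bool (h z)"
  have "?W * ?p = (\<Sum>z \<in> X. exp (\<eta> * hits hs z) * of_bool (h z))"
    using potential_pos[OF assms(1,2), of \<eta> hs]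
    by (simp add: mw_weight_def sum_distrib_left)
  then have "?W * (1 + (exp \<eta> - 1) * ?p)
      = ?W + (exp \<eta> - 1) * (\<Sum>z \<in> X. exp (\<eta> * hits hs z) * of_bool (h z))"
    by (simp add: algebra_simps)
  also have "\<dots> = potential \<eta> X (hs @ [h])"
    unfolding potential_def sum_distrib_left sum.distrib[symmetric]
    by (intro sum.cong refl) (auto simp: exp_add algebra_simps)
  finally have "potential \<eta> X (hs @ [h]) = ?W * (1 + (exp \<eta> - 1) * ?p)" ..
  also have "\<dots> \<le> ?W * exp ((exp \<eta> - 1) * ?p)"
    using potential_pos[OF assms(1,2), of \<eta> hs] by (intro mult_left_mono) auto
  also have "\<dots> \<le> real (card X) * exp ((exp \<eta> - 1) * loss (mw_weight \<eta> X) (\<lambda>_. False) X hs) * exp ((exp \<eta> - 1) * ?p)"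
    by (intro mult_right_mono snoc) simp
  also have "\<dots> = real (card X) * exp ((exp \<eta> - 1) * loss (mw_weight \<eta> X) (\<lambda>_. False) X (hs @ [h]))"
    by (simp add: loss_snoc exp_add ring_distribs)
  finally show ?case .
qed

text \<open>No numerator exceeds \<open>exp (\<eta> * n)\<close>, while every summand of the
  potential is at least 1. A large domain therefore keeps the weights from concentrating on one
  point.\<close>

lemma mw_weight_le:
  assumes "finite X" "X \<noteq> {}" "0 \<le> \<eta>" "length hs \<le> n" "exp (\<eta> * real n) \<le> real (card X) / 4"
  shows "mw_weight \<eta> X hs z \<le> 1/4"
proof -
  have "exp (\<eta> * hits hs z) \<le> exp (\<eta> * real n)"
    using assms(3) le_trans[OF length_filter_le assms(4)] by (auto intro!: mult_left_mono)
  also have "\<dots> \<le> (\<Sum>z \<in> X. 1) / 4" using assms(5) by simp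
  also have "\<dots> \<le> potential \<eta> X hs / 4"
    unfolding potential_def using assms(3) by (intro divide_right_mono sum_mono) auto
  finally show ?thesis
    using potential_pos[OF assms(1,2), of \<eta> hs] by (simp add: mw_weight_def field_simps)
qed

text \<open>In each round twice the loss is 1 if \<open>x\<close> is labelled 0, plus the weight of
  the other points labelled 1. Completing the latter to all points adds at most the weight of
  \<open>x\<close>, hence at most 1/4, which turns the 1 into 3/4.\<close>

lemma loss_point_weight_ge:
  assumes "finite X" "x \<in> X" "0 \<le> \<eta>" "exp (\<eta> * real n) \<le> real (card X) / 4" "length hs \<le> n"
  shows "3/4 * real (length hs) - hits hs x + loss (mw_weight \<eta> X) (\<lambda>_. False) X hs
    \<le> 2 * loss (point_weight \<eta> X x) (\<lambda>z. z = x) X hs"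
  using assms(5)
proof (induction hs rule: rev_induct)
  case (snoc h hs)
  have X: "X \<noteq> {}" using assms(2) by auto
  let ?w = "mw_weight \<eta> X hs"
  have "(\<Sum>z \<in> X. point_weight \<eta> X x hs z * of_bool (h z \<noteq> (z = x)))
      = of_bool (\<not> h x) / 2 + (\<Sum>z \<in> X - {x}. ?w z * of_bool (h z) / 2)"
    unfolding sum.remove[OF assms(1,2)]
    by (intro arg_cong2[where f = "(+)"] sum.cong) (auto simp: point_weight_def)
  moreover have "(\<Sum>z \<in> X. ?w z * of_bool (h z)) / 2
      = ?w x * of_bool (h x) / 2 + (\<Sum>z \<in> X - {x}. ?w z * of_bool (h z) / 2)"
    unfolding sum_divide_distrib using assms(1,2) by (simp add: sum.remove)
  moreover have "?w x * of_bool (h x) \<le> 1/4"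
    using mw_weight_le[OF assms(1) X assms(3) _ assms(4), of hs x] snoc.prems by auto
  ultimately have "3/4 - of_bool (h x) + (\<Sum>z \<in> X. ?w z * of_bool (h z))
      \<le> 2 * (\<Sum>z \<in> X. point_weight \<eta> X x hs z * of_bool (h z \<noteq> (z = x)))"
    by (cases "h x") simp_all
  moreover have "3/4 * real (length hs) - hits hs x + loss (mw_weight \<eta> X) (\<lambda>_. False) X hs
    \<le> 2 * loss (point_weight \<eta> X x) (\<lambda>z. z = x) X hs"
    using snoc by simp
  moreover have "hits (hs @ [h]) x = hits hs x + of_bool (h x)"
    and "real (length (hs @ [h])) = real (length hs) + 1" by simp_all
  ultimately show ?case
    unfolding loss_snoc by (simp only: simp_thms) argo
qed simp

text \<open>A target with small loss was labelled 1 often, so it contributes a large summand to the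
  potential. Comparing with \<open>potential_le\<close> limits the number of such targets; the
  unknown loss \<open>g\<close> cancels to first order in \<open>\<eta>\<close>.\<close>

lemma card_small_loss_points:
  assumes "finite X" "0 < \<eta>" "\<eta> \<le> 1/8" "exp (\<eta> * real n) \<le> real (card X) / 4" "length hs = n"
  shows "real (card {x \<in> X. loss (point_weight \<eta> X x) (\<lambda>z. z = x) X hs \<le> real n / 8})
    \<le> real (card X) * exp (- (3/8) * (\<eta> * real n))"
proof (cases "X = {}")
  case False
  let ?L = "{x \<in> X. loss (point_weight \<eta> X x) (\<lambda>z. z = x) X hs \<le> real n / 8}"
  define g where "g = loss (mw_weight \<eta> X) (\<lambda>_. False) X hs"
  have "g \<le> (\<Sum>t < length hs. 1)"
    unfolding g_def loss_def
  proof (rule sum_mono)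
    fix t
    have "(\<Sum>z \<in> X. mw_weight \<eta> X (take t hs) z * of_bool ((hs ! t) z \<noteq> False))
        \<le> (\<Sum>z \<in> X. mw_weight \<eta> X (take t hs) z)"
      by (intro sum_mono) (simp add: mw_weight_nonneg)
    then show "(\<Sum>z \<in> X. mw_weight \<eta> X (take t hs) z * of_bool ((hs ! t) z \<noteq> False)) \<le> 1"
      using sum_mw_weight[OF assms(1) False] by simp
  qed
  then have g: "g \<le> real n" using assms(5) by simp
  have "real (card ?L) * exp (\<eta> * (real n / 2 + g)) = (\<Sum>x \<in> ?L. exp (\<eta> * (real n / 2 + g)))"
    by simp
  also have "\<dots> \<le> (\<Sum>x \<in> ?L. exp (\<eta> * hits hs x))"
  proof (rule sum_mono)
    fix x assume "x \<in> ?L"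
    \<comment> \<open>Twice the loss is at most \<open>n / 4\<close>, and
      \<open>3/4 - 1/4 = 1/2\<close>.\<close>
    then have "real n / 2 + g \<le> hits hs x"
      using loss_point_weight_ge[OF assms(1) _ _ assms(4), of x hs] assms(2,5)
      by (auto simp: g_def)
    then show "exp (\<eta> * (real n / 2 + g)) \<le> exp (\<eta> * hits hs x)" using assms(2) by simp
  qed
  also have "\<dots> \<le> potential \<eta> X hs"
    unfolding potential_def using assms(1) by (intro sum_mono2) auto
  also have "\<dots> \<le> real (card X) * exp ((exp \<eta> - 1) * g)"
    unfolding g_def using assms by (intro potential_le False) auto
  finally have "real (card ?L) \<le> real (card X) * exp ((exp \<eta> - 1) * g) / exp (\<eta> * (real n / 2 + g))"
    by (simp add: field_simps)
  also have "\<dots> = real (card X) * exp ((exp \<eta> - 1 - \<eta>) * g - \<eta> * real n / 2)"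
    by (simp add: algebra_simps exp_diff exp_add)
  also have "\<dots> \<le> real (card X) * exp (- (3/8) * (\<eta> * real n))"
  proof -
    \<comment> \<open>The remainder is quadratic in \<open>\<eta>\<close>, hence at most
      \<open>\<eta> / 8\<close>; with \<open>g \<le> n\<close> the exponent becomes
      \<open>(1/8 - 1/2) * \<eta> * n\<close>.\<close>
    have "exp \<eta> - 1 - \<eta> \<le> \<eta>\<^sup>2" using exp_bound[of \<eta>] assms by simp
    also have "\<dots> \<le> \<eta> / 8" using assms by (simp add: power2_eq_square)
    finally have "(exp \<eta> - 1 - \<eta>) * g \<le> \<eta> / 8 * real n"
      using g assms(2) by (intro mult_mono) (auto simp: g_def loss_nonneg mw_weight_nonneg)
    then show ?thesis by (intro mult_left_mono) auto
  qed
  finally show ?thesis .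
qed simp


section \<open>The lower bound\<close>

lemma mistakes_le: "mistakes A B t \<le> t"
  by (induction t) (auto simp: mistakes_Suc of_bool_def)

text \<open>Lets the analysis stop after \<open>n\<close> rounds when \<open>T\<close> is too large
  for group privacy.\<close>

lemma expected_mistakes_return_ge:
  assumes "n \<le> T"
  shows "measure_pmf.expectation \<A> (\<lambda>A. real (mistakes A B n)) \<le> expected_mistakes T \<A> (return_pmf B)"
proof -
  have int: "integrable (measure_pmf \<A>) (\<lambda>A. real (mistakes A B t))" for t
    by (rule measure_pmf.integrable_const_bound[where B = "real t"]) (auto simp: mistakes_le)
  have "expected_mistakes T \<A> (return_pmf B) = measure_pmf.expectation \<A> (\<lambda>A. real (mistakes A B T))"
    by (simp add: expected_mistakes_def pair_return_pmf2)
  moreover have "measure_pmf.expectation \<A> (\<lambda>A. real (mistakes A B n))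
      \<le> measure_pmf.expectation \<A> (\<lambda>A. real (mistakes A B T))"
    by (intro integral_mono int) (simp add: mistakes_mono assms)
  ultimately show ?thesis by simp
qed

lemma realizable_greedy:
  assumes "x \<in> {1..d}"
  shows "realizable_adversary {1..d} (point_class d) T (return_pmf (greedy \<A> {1..d} (\<lambda>z. z = x)))"
proof -
  let ?B = "greedy \<A> {1..d} (\<lambda>z. z = x)"
  have B: "\<exists>z \<in> {1..d}. ?B p = (z, z = x)" for p
    using greedy_maximizes[of "{1..d}" \<A> "\<lambda>z. z = x" p] assms by fastforce
  have "set (play A ?B t) \<subseteq> UNIV \<times> (\<lambda>z. (z, z = x)) ` {1..d}" for A t
  proof (induction t)
    case (Suc t)
    then show ?case using B[of "play A ?B t"] by (auto simp: Let_def)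
  qed simp
  \<comment> \<open>The adversary labels by the unrestricted indicator of \<open>x\<close>, which
    agrees on the domain with the extensional member of the class.\<close>
  then have play: "\<forall>(h, z, y) \<in> set (play A ?B T). z \<in> {1..d} \<and> y = (\<lambda>z\<in>{1..d}. z = x) z" for A
    by fastforce
  have "(\<lambda>z\<in>{1..d}. z = x) \<in> point_class d" using assms by (auto simp: point_class_def)
  then show ?thesis
    unfolding realizable_adversary_def set_return_pmf
    by (intro ballI allI impI bexI[of _ "\<lambda>z\<in>{1..d}. z = x"]) (simp only: singleton_iff play)
qed

text \<open>The two targets disagree at both \<open>a\<close> and \<open>b\<close>, so at each of
  these points every hypothesis errs for exactly one of them.\<close>

lemma loss_pair:
  assumes "finite X" "a \<in> X" "b \<in> X" "a \<noteq> b"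
  defines "v \<equiv> \<lambda>_ z. if z \<in> {a, b} then 1/2 else 0"
  shows "loss v (\<lambda>z. z = a) X hs + loss v (\<lambda>z. z = b) X hs = real (length hs)"
proof (induction hs rule: rev_induct)
  case (snoc h hs)
  have "(\<Sum>z \<in> X. v hs z * g z) = (\<Sum>z \<in> {a, b}. v hs z * g z)" for g :: "_ \<Rightarrow> real"
    using assms(1-3) by (intro sum.mono_neutral_right) (auto simp: v_def)
  then have "(\<Sum>z \<in> X. v hs z * g z) = g a / 2 + g b / 2" for g :: "_ \<Rightarrow> real"
    using assms(4) by (simp add: v_def)
  then show ?case using snoc assms(4) by (auto simp: loss_snoc)
qed simp

text \<open>The losses for the targets 1 and 2 sum to \<open>n\<close>, so at most one of them is at
  most \<open>n / 8\<close>. Group privacy costs at most \<open>exp (1/3) \<le> 3/2\<close>, which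
  is 3/4 of the two targets.\<close>

lemma costly_point_few_rounds:
  fixes d :: nat
  assumes "2 \<le> d" and alg: "online_algorithm {1..d} T \<A>" and priv: "adaptively_private {1..d} T \<epsilon> \<A>"
    and n: "n \<le> T" "1 \<le> n" "\<epsilon> * real n \<le> 1/3"
  shows "\<exists>x \<in> {1..d}. real n / 8 / 4 \<le>
    measure_pmf.expectation \<A> (\<lambda>A. real (mistakes A (greedy \<A> {1..d} (\<lambda>z. z = x)) n))"
proof -
  let ?v = "\<lambda>(_::nat hypothesis list) (z::nat). if z \<in> {1, 2} then 1/2 else 0 :: real"
  have "exp (\<epsilon> * real n) \<le> exp (1/3)" using n by simp
  also have "\<dots> \<le> 3/2" using exp_bound[of "1/3"] by (simp add: power2_eq_square)
  finally have c: "exp (\<epsilon> * real n) \<le> 3/2" .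
  have "\<exists>x \<in> {1, 2}. real n / 8 / 4 \<le>
    measure_pmf.expectation \<A> (\<lambda>A. real (mistakes A (greedy \<A> {1..d} (\<lambda>z. z = x)) n))"
  proof (rule exists_costly_target[OF _ _ alg priv n(1), where v = "\<lambda>_. ?v" and f = "\<lambda>x z. z = x"])
    have "(\<Sum>z \<in> {1..d}. ?v hs z) = (\<Sum>z \<in> {1, 2}. ?v hs z)" for hs
      using assms(1) by (intro sum.mono_neutral_right) auto
    then show "(\<Sum>z \<in> {1..d}. ?v hs z) \<le> 1" for hs by simp
    fix hs :: "nat hypothesis list" assume hs: "length hs = n"
    let ?L = "{x \<in> {1, 2}. loss ?v (\<lambda>z. z = x) {1..d} hs \<le> real n / 8}"
    have "loss ?v (\<lambda>z. z = 1) {1..d} hs + loss ?v (\<lambda>z. z = 2) {1..d} hs = real n"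
      using loss_pair[of "{1..d}" 1 2 hs] assms(1) hs by simp
    then have "1 \<notin> ?L \<or> 2 \<notin> ?L"
      using n(2) by (simp only: mem_Collect_eq) linarith
    then have "\<exists>a. ?L \<subseteq> {a}" by blast
    then obtain a where "?L \<subseteq> {a}" ..
    from card_mono[OF _ this] have "card ?L \<le> 1" by simp
    then have "exp (\<epsilon> * real n) * real (card ?L) \<le> 3/2 * 1" by (intro mult_mono c) auto
    then show "exp (\<epsilon> * real n) * real (card ?L) \<le> 3/4 * real (card {1, 2 :: nat})" by simp
  qed (use assms(1) in auto)
  then show ?thesis using assms(1) by auto
qed

text \<open>The rate \<open>\<eta> = 4 * \<epsilon>\<close> makes the fraction of cheap targets at
  most \<open>exp (- 3/2 * \<epsilon> * n)\<close>. This beats the group privacy factor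
  \<open>exp (\<epsilon> * n)\<close> and leaves \<open>exp (- \<epsilon> * n / 2)\<close>, at most
  3/4 once \<open>\<epsilon> * n \<ge> 1\<close>.\<close>

lemma costly_point_many_rounds:
  assumes alg: "online_algorithm {1..d} T \<A>" and priv: "adaptively_private {1..d} T \<epsilon> \<A>"
    and \<epsilon>: "0 < \<epsilon>" "\<epsilon> \<le> 1/32" and n: "n \<le> T" "1 \<le> \<epsilon> * real n" and d: "exp (4 * \<epsilon> * real n) \<le> real d / 4"
  shows "\<exists>x \<in> {1..d}. real n / 8 / 4 \<le>
    measure_pmf.expectation \<A> (\<lambda>A. real (mistakes A (greedy \<A> {1..d} (\<lambda>z. z = x)) n))"
proof (rule exists_costly_target[OF _ _ alg priv n(1), where v = "point_weight (4 * \<epsilon>) {1..d}" and f = "\<lambda>x z. z = x"])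
  have "real d > 0" using d exp_gt_zero[of "4 * \<epsilon> * real n"] by linarith
  then show "{1..d} \<noteq> {}" "{1..d} \<noteq> {}" by auto
  have half: "exp (- (1/2)) \<le> (3/4 :: real)"
    using exp_ge_add_one_self[of "1/2"] by (simp add: exp_minus field_simps)
  fix hs :: "nat hypothesis list" assume hs: "length hs = n"
  let ?L = "{x \<in> {1..d}. loss (point_weight (4 * \<epsilon>) {1..d} x) (\<lambda>z. z = x) {1..d} hs \<le> real n / 8}"
  have "real (card ?L) \<le> real d * exp (- (3/8) * (4 * \<epsilon> * real n))"
    using card_small_loss_points[of "{1..d}" "4 * \<epsilon>" n hs] \<epsilon> d hs by simp
  then have "exp (\<epsilon> * real n) * real (card ?L)
      \<le> exp (\<epsilon> * real n) * (real d * exp (- (3/8) * (4 * \<epsilon> * real n)))"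
    by (intro mult_left_mono) auto
  also have "\<dots> = real d * exp (- (\<epsilon> * real n / 2))"
    by (simp only: mult.left_commute[of "exp _" "real d"] exp_add[symmetric]) simp
  also have "\<dots> \<le> real d * exp (- (1/2))" using n(2) by (intro mult_left_mono) auto
  also have "\<dots> \<le> real d * (3/4)" by (intro mult_left_mono half) simp
  finally show "exp (\<epsilon> * real n) * real (card ?L) \<le> 3/4 * real (card {1..d})" by simp
next
  fix x hs z assume "x \<in> {1..d}"
  then show "(\<Sum>z \<in> {1..d}. point_weight (4 * \<epsilon>) {1..d} x hs z) \<le> 1"
    by (intro sum_point_weight_le) simp_all
  show "0 \<le> point_weight (4 * \<epsilon>) {1..d} x hs z"
    by (simp add: point_weight_def mw_weight_nonneg)
qed simp_all

theorem theorem3p5: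
  "\<exists>\<epsilon>\<^sub>0 > (0::real). \<exists>C > (0::real).
     \<forall>(\<epsilon>::real) (d::nat) (T::nat).
       0 < \<epsilon> \<and> \<epsilon> \<le> \<epsilon>\<^sub>0 \<and> 2 \<le> d \<and> 1 \<le> T \<longrightarrow>
       (\<forall>\<A> :: nat learner pmf.
          online_algorithm {1..d} T \<A> \<and> adaptively_private {1..d} T \<epsilon> \<A> \<longrightarrow>
          (\<exists>\<B> :: nat adversary pmf.
             realizable_adversary {1..d} (point_class d) T \<B> \<and>
             expected_mistakes T \<A> \<B> \<ge> C * min (ln (real d) / \<epsilon>) (real T)))"
\<comment> \<open>The bound \<open>1/32\<close> ensures \<open>4 * \<epsilon> \<le> 1/8\<close>. The
  constant is \<open>1 / (96 * 32)\<close>: the minimum is at most \<open>96 * n\<close>, and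
  \<open>n\<close> rounds cost at least \<open>n / 32\<close> mistakes.\<close>
proof (rule exI[of _ "1/32"], rule conjI, simp, rule exI[of _ "1/3072"], rule conjI, simp,
    intro allI impI, elim conjE)
  fix \<epsilon> :: real and d T :: nat and \<A> :: "nat learner pmf"
  assume \<epsilon>: "0 < \<epsilon>" "\<epsilon> \<le> 1/32" and d: "2 \<le> d" and T: "1 \<le> T"
    and alg: "online_algorithm {1..d} T \<A>" and priv: "adaptively_private {1..d} T \<epsilon> \<A>"
  let ?cost = "\<lambda>x n. measure_pmf.expectation \<A> (\<lambda>A. real (mistakes A (greedy \<A> {1..d} (\<lambda>z. z = x)) n))"
  have "\<exists>n \<le> T. min (ln (real d) / \<epsilon>) (real T) \<le> 96 * real n \<and> (\<exists>x \<in> {1..d}. real n / 8 / 4 \<le> ?cost x n)"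
  proof (cases "16 \<le> ln (real d) \<and> 1 \<le> \<epsilon> * real T")
    case True
    \<comment> \<open>With \<open>8 * \<epsilon> * m \<le> ln d\<close> and
      \<open>ln d \<ge> 16\<close>, the exponent \<open>4 * \<epsilon> * n\<close> is at most
      \<open>ln d / 2 \<le> ln d - 8\<close>, which leaves room for the factor 1/4. Rounding down
      loses at most \<open>8 * \<epsilon> \<le> 1/4\<close> in
      \<open>8 * \<epsilon> * m\<close>.\<close>
    define m where "m = nat \<lfloor>ln (real d) / (8 * \<epsilon>)\<rfloor>"
    have m: "real m \<le> ln (real d) / (8 * \<epsilon>)" "ln (real d) / (8 * \<epsilon>) < real m + 1"
      using True \<epsilon> by (auto simp: m_def intro!: of_nat_floor)
    have m': "8 * (\<epsilon> * real m) \<le> ln (real d)" "ln (real d) < 8 * (\<epsilon> * real m) + 8 * \<epsilon>"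
      using m \<epsilon> by (auto simp: field_simps)
    define n where "n = min T m"
    have "1 \<le> \<epsilon> * real m" using m' True \<epsilon> by linarith
    then have n1: "1 \<le> \<epsilon> * real n" using True by (auto simp: n_def min_def)
    have "\<epsilon> * real n \<le> \<epsilon> * real m" using \<epsilon> by (intro mult_left_mono) (auto simp: n_def)
    then have "4 * \<epsilon> * real n \<le> ln (real d) - 8" using m' True by linarith
    then have "exp (4 * \<epsilon> * real n) \<le> exp (ln (real d) - 8)" by simp
    also have "\<dots> = real d / exp 8" using d by (simp add: exp_diff)
    also have "\<dots> \<le> real d / 4" using exp_ge_add_one_self[of 8] by (intro divide_left_mono) auto
    finally have "\<exists>x \<in> {1..d}. real n / 8 / 4 \<le> ?cost x n"
      using costly_point_many_rounds[OF alg priv \<epsilon> _ n1] by (simp add: n_def)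
    moreover have "ln (real d) / \<epsilon> \<le> 96 * real m"
    proof -
      have "ln (real d) \<le> 96 * (\<epsilon> * real m)" using m' True \<epsilon> by linarith
      then show ?thesis using \<epsilon> by (simp add: field_simps)
    qed
    ultimately show ?thesis by (intro exI[of _ n]) (auto simp: n_def min_def)
  next
    case False
    \<comment> \<open>The largest number of rounds with \<open>\<epsilon> * m \<le> 1/3\<close>, as
      the argument with two targets requires.\<close>
    define m where "m = nat \<lfloor>1 / (3 * \<epsilon>)\<rfloor>"
    have m: "real m \<le> 1 / (3 * \<epsilon>)" "1 / (3 * \<epsilon>) < real m + 1"
      using \<epsilon> by (auto simp: m_def intro!: of_nat_floor)
    have m': "3 * (\<epsilon> * real m) \<le> 1" "1 < 3 * (\<epsilon> * real m) + 3 * \<epsilon>"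
      using m \<epsilon> by (auto simp: field_simps)
    have "m \<noteq> 0" using m' \<epsilon> by (intro notI) simp
    define n where "n = min T m"
    have "\<epsilon> * real n \<le> \<epsilon> * real m" using \<epsilon> by (intro mult_left_mono) (auto simp: n_def)
    then have "\<epsilon> * real n \<le> 1/3" using m' by linarith
    then have "\<exists>x \<in> {1..d}. real n / 8 / 4 \<le> ?cost x n"
      using T \<open>m \<noteq> 0\<close> by (intro costly_point_few_rounds[OF d alg priv]) (simp_all add: n_def)
    \<comment> \<open>Here \<open>ln d < 16\<close> or \<open>\<epsilon> * T < 1\<close>, so the
      minimum is below 16, whereas \<open>3 * \<epsilon> * m > 29/32\<close> gives
      \<open>96 * \<epsilon> * m > 29\<close>.\<close>
    moreover have "min (ln (real d)) (\<epsilon> * real T) \<le> \<epsilon> * (96 * real m)" using False m' \<epsilon> by auto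
    then have "min (ln (real d) / \<epsilon>) (real T) \<le> 96 * real m"
      using \<epsilon> by (auto simp: field_simps min_le_iff_disj)
    ultimately show ?thesis by (intro exI[of _ n]) (auto simp: n_def min_def)
  qed
  then obtain n x where nx: "n \<le> T" "min (ln (real d) / \<epsilon>) (real T) \<le> 96 * real n"
    "x \<in> {1..d}" "real n / 8 / 4 \<le> ?cost x n" by blast
  let ?B = "return_pmf (greedy \<A> {1..d} (\<lambda>z. z = x))"
  have "1/3072 * min (ln (real d) / \<epsilon>) (real T) \<le> expected_mistakes T \<A> ?B"
    using nx(2,4) expected_mistakes_return_ge[OF nx(1), of \<A> "greedy \<A> {1..d} (\<lambda>z. z = x)"] by linarith
  then show "\<exists>\<B>. realizable_adversary {1..d} (point_class d) T \<B> \<and>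
      1/3072 * min (ln (real d) / \<epsilon>) (real T) \<le> expected_mistakes T \<A> \<B>"
    using realizable_greedy[OF nx(3)] by blast
qed

end
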